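(* Let $G$ be the complete graph on $\{0,\dots,n\}$ oriented by $i\to j$ iff $i<j$. For every spanning tree $T\in\mathbb{B}(G)$, $$p_{G\setminus T}=\sum_{s\in S_n}(-1)^{\operatorname{mm}(G\setminus T,\,s)}\,C(T,T_s)\,\mathbf{P}_s .$$
   Context: Polynomials are in variables $t=(t(1),\dots,t(n))$ with $t(0):=0$. To the edge of $G$ between $i<j$ associate $p_x(t)=t(j)-t(i)$; for a set $Y$ of edges oriented as in $G$, $p_Y:=\prod_{x\in Y}p_x$. $\mathbb{B}(G)$ is the set of spanning trees of $G$; $G\setminus T$ is the set of edges not in $T$. $S_n$ is the set of permutations of $\{1,\dots,n\}$, extended by $s(0):=0$. For $s\in S_n$, $G^s$ orients the edge $\{s(i),s(j)\}$, $i<j$, as $s(i)\to s(j)$. The path tree $T_s$ is the spanning tree with edges $\{s(k-1),s(k)\}$, $k=1,\dots,n$. $\mathbf{P}_s:=\prod(t(s(j))-t(s(i)))$ over all $0\le i<j\le n$ with $j\ne i+1$. For a set $Y$ of edges and $s\in S_n$, $\operatorname{mm}(Y,s)$ is the number of edges of $Y$ whose orientation in $G$ differs from their orientation in $G^s$ (i.e. edges $\{a,b\}$, $a<b$, with $s^{-1}(a)>s^{-1}(b)$). For $T\in\mathbb{B}(G)$: $i\prec_T j$ iff $i\neq j$ and the path in $T$ from $0$ to $j$ contains $i$; $T,T'$ are compatible if some total order on $\{0,\dots,n\}$ extends both $\prec_T$ and $\prec_{T'}$; $C(T,T')=1$ if compatible, $0$ otherwise. *)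

theory Defs
  imports Main "HOL-Combinatorics.Permutations"
begin

definition edges :: "nat \<Rightarrow> (nat \<times> nat) set" where
  "edges n = {(i, j). i < j \<and> j \<le> n}"

definition adj :: "(nat \<times> nat) set \<Rightarrow> nat \<Rightarrow> nat \<Rightarrow> bool" where
  "adj T a b \<longleftrightarrow> a \<noteq> b \<and> (min a b, max a b) \<in> T"

definition is_path :: "(nat \<times> nat) set \<Rightarrow> nat list \<Rightarrow> bool" where
  "is_path T p \<longleftrightarrow> p \<noteq> [] \<and> distinct p \<and>
     (\<forall>k. Suc k < length p \<longrightarrow> adj T (p ! k) (p ! Suc k))"

definition is_cycle :: "(nat \<times> nat) set \<Rightarrow> nat list \<Rightarrow> bool" where
  "is_cycle T c \<longleftrightarrow> length c \<ge> 3 \<and> is_path T c \<and> adj T (last c) (hd c)"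

definition spanning_tree :: "nat \<Rightarrow> (nat \<times> nat) set \<Rightarrow> bool" where
  "spanning_tree n T \<longleftrightarrow> T \<subseteq> edges n
     \<and> (\<forall>j \<le> n. \<exists>p. is_path T p \<and> hd p = 0 \<and> last p = j)
     \<and> (\<nexists>c. is_cycle T c)"

text \<open>i \<prec>_T j: i \<noteq> j and the path in T from 0 to j contains i
  (in a tree this path is unique).\<close>
definition tree_prec :: "(nat \<times> nat) set \<Rightarrow> nat \<Rightarrow> nat \<Rightarrow> bool" where
  "tree_prec T i j \<longleftrightarrow> i \<noteq> j \<and> (\<exists>p. is_path T p \<and> hd p = 0 \<and> last p = j \<and> i \<in> set p)"

definition compatible :: "nat \<Rightarrow> (nat \<times> nat) set \<Rightarrow> (nat \<times> nat) set \<Rightarrow> bool" where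
  "compatible n T T' \<longleftrightarrow> (\<exists>R. strict_linear_order_on {0..n} R \<and>
      (\<forall>i \<le> n. \<forall>j \<le> n. (tree_prec T i j \<or> tree_prec T' i j) \<longrightarrow> (i, j) \<in> R))"

definition C :: "nat \<Rightarrow> (nat \<times> nat) set \<Rightarrow> (nat \<times> nat) set \<Rightarrow> 'a::comm_ring_1" where
  "C n T T' = (if compatible n T T' then 1 else 0)"

text \<open>Path tree T_s: edges {s(k-1), s(k)}, k = 1..n (s 0 = 0 since s permutes {1..n}).\<close>
definition path_tree :: "nat \<Rightarrow> (nat \<Rightarrow> nat) \<Rightarrow> (nat \<times> nat) set" where
  "path_tree n s = {(min (s (k - 1)) (s k), max (s (k - 1)) (s k)) | k. 1 \<le> k \<and> k \<le> n}"

text \<open>p_Y evaluated at t (with t 0 = 0).\<close>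
definition pY :: "(nat \<Rightarrow> 'a::comm_ring_1) \<Rightarrow> (nat \<times> nat) set \<Rightarrow> 'a" where
  "pY t Y = (\<Prod>(i, j)\<in>Y. t j - t i)"

definition bigP :: "nat \<Rightarrow> (nat \<Rightarrow> 'a::comm_ring_1) \<Rightarrow> (nat \<Rightarrow> nat) \<Rightarrow> 'a" where
  "bigP n t s = (\<Prod>(i, j)\<in>{(i, j). i < j \<and> j \<le> n \<and> j \<noteq> i + 1}. t (s j) - t (s i))"

definition mm :: "(nat \<times> nat) set \<Rightarrow> (nat \<Rightarrow> nat) \<Rightarrow> nat" where
  "mm Y s = card {(a, b) \<in> Y. inv s a > inv s b}"

end

theory Submission
  imports Defs
begin

text \<open>Root the tree at 0 and let f map every other vertex to its parent. The permutations s
with s-order compatible with T are the linear extensions of the tree order. If two vertices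
a, b have the same parent p, every linear extension puts a before b or b before a; so the
linear extensions of T are those of the two trees in which b is hung below a, respectively
a below b. Up to common factors the left-hand side splits in the same way, because
(t b - t p) - (t a - t p) = t b - t a. Since each of these trees has fewer linear extensions,
induction leads to the case of an injective f, where T is a path, s is unique, and the two
sides agree factor by factor.\<close>

section \<open>Trees given by parent functions\<close>

text \<open>Pairs run from parent to child, and the root 0 has no parent. Acyclicity together with
  \<open>f v \<le> n\<close> makes every chain of parents end at 0, so that \<open>f\<close> encodes
  a tree rooted at 0.\<close>

definition parent_rel :: "nat \<Rightarrow> (nat \<Rightarrow> nat) \<Rightarrow> (nat \<times> nat) set" where
  "parent_rel n f = {(f v, v) | v. v \<in> {1..n}}"

text \<open>\<open>inv s v\<close> is the position of \<open>v\<close> in the list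
  \<open>s 0, ..., s n\<close>. Comparing each vertex with its parent suffices; the other ancestors
  follow by transitivity.\<close>

definition lin_exts :: "nat \<Rightarrow> (nat \<Rightarrow> nat) \<Rightarrow> (nat \<Rightarrow> nat) set" where
  "lin_exts n f = {s. s permutes {1..n} \<and> (\<forall>v\<in>{1..n}. inv s (f v) < inv s v)}"

definition edge :: "nat \<Rightarrow> nat \<Rightarrow> nat \<times> nat" where
  "edge a b = (min a b, max a b)"

definition parent_edges :: "nat \<Rightarrow> (nat \<Rightarrow> nat) \<Rightarrow> (nat \<times> nat) set" where
  "parent_edges n f = (\<lambda>v. edge (f v) v) ` {1..n}"

text \<open>The contribution of one edge to \<open>(-1) ^ mm Y s\<close>; as a product over edges,
  the sign can be split off edge by edge.\<close>

definition inv_sign :: "(nat \<Rightarrow> nat) \<Rightarrow> nat \<times> nat \<Rightarrow> 'a::comm_ring_1" where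
  "inv_sign s e = (if inv s (fst e) > inv s (snd e) then -1 else 1)"

section \<open>Elementary facts on edges, signs and positions\<close>

lemma lin_extsD:
  assumes "s \<in> lin_exts n f"
  shows "s permutes {1..n}" and "v \<in> {1..n} \<Longrightarrow> inv s (f v) < inv s v"
  by (use assms in \<open>auto simp: lin_exts_def\<close>)

lemma edge_commute: "edge a b = edge b a"
  by (simp add: edge_def min.commute max.commute)

lemma edge_eq_if: "edge a b = (if a < b then (a, b) else (b, a))"
  by (simp add: edge_def)

lemma edge_eq_iff: "edge a b = edge c d \<longleftrightarrow> (a = c \<and> b = d) \<or> (a = d \<and> b = c)"
  by (auto simp: edge_def min_def max_def split: if_splits)

lemma edge_in_edges: "a \<noteq> b \<Longrightarrow> a \<le> n \<Longrightarrow> b \<le> n \<Longrightarrow> edge a b \<in> edges n"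
  by (auto simp: edge_def edges_def)

lemma finite_edges [simp]: "finite (edges n)"
  by (rule finite_subset[of _ "{..n} \<times> {..n}"]) (auto simp: edges_def)

lemma finite_lin_exts [simp]: "finite (lin_exts n f)"
  by (rule finite_subset[OF _ finite_permutations[of "{1..n}"]]) (auto simp: lin_exts_def)

lemma minus_one_power_mm:
  assumes "finite Y"
  shows "(-1) ^ mm Y s = (\<Prod>e\<in>Y. inv_sign s e :: 'a::comm_ring_1)"
proof -
  have "(\<Prod>e\<in>Y. inv_sign s e :: 'a) = (\<Prod>e\<in>{e\<in>Y. inv s (fst e) > inv s (snd e)}. -1)"
    unfolding inv_sign_def using assms
    by (simp add: prod.If_cases Int_def)
  moreover have "{e\<in>Y. inv s (fst e) > inv s (snd e)} = {(a, b) \<in> Y. inv s a > inv s b}"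
    by auto
  ultimately show ?thesis by (simp add: mm_def)
qed

text \<open>Where the orientations in G and in \<open>G^s\<close> differ, both the sign and the
  linear factor change sign.\<close>

lemma inv_sign_mult_diff:
  fixes t :: "nat \<Rightarrow> 'a::comm_ring_1"
  assumes "inv s a < inv s b"
  shows "inv_sign s (edge a b) * (case edge a b of (i, j) \<Rightarrow> t j - t i) = t b - t a"
  by (use assms in \<open>auto simp: inv_sign_def edge_def min_def max_def\<close>)

lemma inv_sign_square [simp]: "inv_sign s e * inv_sign s e = 1"
  by (simp add: inv_sign_def)

lemma permutes_zero:
  assumes "s permutes {1..n}" shows "s 0 = (0::nat)" "inv s 0 = 0"
  by (use assms permutes_inv[OF assms] in \<open>auto simp: permutes_not_in\<close>)

lemma permutes_le_iff:
  assumes "s permutes {1..n}" shows "s k \<le> n \<longleftrightarrow> k \<le> (n::nat)"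
  by (use permutes_in_image[OF assms, of k] permutes_zero[OF assms] permutes_not_in[OF assms, of k]
    in \<open>cases "k = 0"; auto simp: not_le\<close>)

lemma acyclic_parent_neq:
  assumes "acyclic (parent_rel n f)" "v \<in> {1..n}"
  shows "f v \<noteq> v"
  by (use assms in \<open>auto simp: parent_rel_def acyclic_def\<close>)

lemma finite_parent_rel [simp]: "finite (parent_rel n f)"
  by (simp add: parent_rel_def setcompr_eq_image)

text \<open>Sorting the vertices by their number of ancestors puts parents before children. In the
  induction, nonemptiness of one half of a split makes the other half strictly smaller.\<close>

lemma lin_exts_nonempty:
  assumes ac: "acyclic (parent_rel n f)" and le: "\<And>v. v \<in> {1..n} \<Longrightarrow> f v \<le> n"
  shows "lin_exts n f \<noteq> {}"
proof -
  define R where "R = (parent_rel n f)\<^sup>+"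
  have finR: "finite R" by (simp add: R_def)
  define below where "below v = {u. (u, v) \<in> R}" for v
  have finb: "finite (below v)" for v
    by (rule finite_subset[of _ "fst ` R"]) (force simp: below_def, simp add: finR)
  define r where "r v = card (below v) * (n + 1) + v" for v
  \<comment> \<open>The summand v breaks ties, which makes r injective on the vertices.\<close>
  have r0: "r 0 = 0"
  proof -
    have "below 0 = {}"
      unfolding below_def R_def by (auto elim: tranclE simp: parent_rel_def)
    then show ?thesis by (simp add: r_def)
  qed
  have rless: "r (f v) < r v" if v: "v \<in> {1..n}" for v
  proof -
    have e: "(f v, v) \<in> R" unfolding R_def parent_rel_def using v by blast
    have "below (f v) \<subset> below v"
    proof
      show "below (f v) \<subseteq> below v" using e
        by (auto simp: below_def R_def)
      show "below (f v) \<noteq> below v" using e ac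
        by (auto simp: below_def R_def acyclic_def)
    qed
    then have "card (below (f v)) < card (below v)"
      by (simp add: finb psubset_card_mono)
    \<comment> \<open>The weight \<open>n + 1\<close> exceeds every label, so one more ancestor
      outweighs any difference of labels.\<close>
    then have "(card (below (f v)) + 1) * (n+1) \<le> card (below v) * (n+1)"
      by (intro mult_le_mono1) simp
    then show ?thesis using le[OF v] v by (auto simp: r_def)
  qed
  have rinj: "r u = r v \<longleftrightarrow> u = v" if "u \<le> n" "v \<le> n" for u v
  proof
    assume "r u = r v"
    then have "r u mod (n+1) = r v mod (n+1)" by simp
    then show "u = v" using that unfolding r_def by (simp only: mod_mult_self3) simp
  qed simp
  \<comment> \<open>The rank of \<open>v\<close> with respect to \<open>r\<close>, continued by the
    identity so that it can be a permutation of \<open>{1..n}\<close>.\<close>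
  define pos where "pos v = (if v \<le> n then card {u. u \<le> n \<and> r u < r v} else v)" for v
  have pos_less: "pos u < pos v" if "u \<le> n" "v \<le> n" "r u < r v" for u v
  proof -
    have "{w. w \<le> n \<and> r w < r u} \<subset> {w. w \<le> n \<and> r w < r v}"
      using that by auto
    then show ?thesis using that by (auto simp: pos_def intro!: psubset_card_mono)
  qed
  have inj: "inj_on pos {0..n}"
  proof (rule inj_onI)
    fix u v assume "u \<in> {0..n}" "v \<in> {0..n}" "pos u = pos v"
    then show "u = v" using pos_less[of u v] pos_less[of v u] rinj[of u v]
      by (cases "r u" "r v" rule: linorder_cases) auto
  qed
  have pos0: "pos 0 = 0" by (simp add: pos_def r0)
  have ge1: "pos v \<in> {1..n}" if v: "v \<in> {1..n}" for v
  proof -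
    have "pos v \<noteq> pos 0" using inj_onD[OF inj, of v 0] v by auto
    moreover have "pos v \<le> n"
    proof -
      have "card {u. u \<le> n \<and> r u < r v} \<le> card ({..n} - {v})"
        by (rule card_mono) auto
      then show ?thesis using v by (simp add: pos_def)
    qed
    ultimately show ?thesis using pos0 by simp
  qed
  have perm: "pos permutes {1..n}"
  proof (rule bij_imp_permutes)
    have i: "inj_on pos {1..n}" by (rule inj_on_subset[OF inj]) auto
    show "bij_betw pos {1..n} {1..n}"
      unfolding bij_betw_def using endo_inj_surj[OF _ image_subsetI[OF ge1] i] i by simp
    show "\<And>x. x \<notin> {1..n} \<Longrightarrow> pos x = x" using pos0 by (case_tac "x = 0") (auto simp: pos_def)
  qed
  \<comment> \<open>\<open>pos\<close> maps vertices to positions, while a linear extension maps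
    positions to vertices.\<close>
  have "inv pos \<in> lin_exts n f"
    using pos_less[OF le _ rless] permutes_inv[OF perm]
    by (simp add: lin_exts_def inv_inv_eq[OF permutes_bij[OF perm]])
  then show ?thesis by blast
qed

section \<open>Splitting at two siblings\<close>

text \<open>The new pair \<open>(a, b)\<close> could close a cycle only if \<open>b\<close> were an
  ancestor of \<open>a\<close>. Then \<open>b\<close> would also be an ancestor of, or equal to, the
  common parent, which already gives a cycle through \<open>b\<close>.\<close>

lemma acyclic_parent_rel_update:
  assumes ac: "acyclic (parent_rel n f)" and ab: "a \<in> {1..n}" "b \<in> {1..n}" "a \<noteq> b" "f a = f b"
  shows "acyclic (parent_rel n (f(b := a)))"
proof -
  have "(b, a) \<notin> (parent_rel n f)\<^sup>*"
  proof
    assume "(b, a) \<in> (parent_rel n f)\<^sup>*"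
    with \<open>a \<noteq> b\<close> obtain c where c: "(b, c) \<in> (parent_rel n f)\<^sup>*" "(c, a) \<in> parent_rel n f"
      by (metis rtranclE)
    then have "c = f b" using ab by (auto simp: parent_rel_def)
    then have "(c, b) \<in> parent_rel n f" using ab by (auto simp: parent_rel_def)
    with c(1) have "(b, b) \<in> (parent_rel n f)\<^sup>+" by (rule rtrancl_into_trancl1)
    with ac show False by (auto simp: acyclic_def)
  qed
  with ac have "acyclic (insert (a, b) (parent_rel n f))" by (simp add: acyclic_insert)
  moreover have "parent_rel n (f(b := a)) \<subseteq> insert (a, b) (parent_rel n f)"
    by (auto simp: parent_rel_def)
  ultimately show ?thesis by (rule acyclic_subset)
qed

text \<open>Siblings occupy different positions, so exactly one of the two orders holds. Conversely,
  the dropped condition that the parent precedes \<open>b\<close> follows from parent before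
  \<open>a\<close> before \<open>b\<close>, and likewise with the roles exchanged.\<close>

lemma lin_exts_split:
  assumes ab: "a \<in> {1..n}" "b \<in> {1..n}" "a \<noteq> b" "f a = f b"
  shows "lin_exts n f = lin_exts n (f(b := a)) \<union> lin_exts n (f(a := b))"
    and "lin_exts n (f(b := a)) \<inter> lin_exts n (f(a := b)) = {}"
proof -
  have 1: "inv s a \<noteq> inv s b" if "s permutes {1..n}" for s
    using permutes_inj[OF permutes_inv[OF that]] ab by (auto dest: injD)
  show "lin_exts n f = lin_exts n (f(b := a)) \<union> lin_exts n (f(a := b))"
  proof (intro equalityI subsetI)
    fix s assume "s \<in> lin_exts n f"
    then show "s \<in> lin_exts n (f(b := a)) \<union> lin_exts n (f(a := b))"
      using 1[of s] by (auto simp: lin_exts_def)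
  next
    fix s assume s: "s \<in> lin_exts n (f(b := a)) \<union> lin_exts n (f(a := b))"
    have "inv s (f v) < inv s v" if v: "v \<in> {1..n}" for v
    proof -
      have "inv s (f v) < inv s v" if "s \<in> lin_exts n (f(y := x))"
        "x \<in> {1..n}" "y \<in> {1..n}" "x \<noteq> y" "f x = f y" for x y
      proof -
        have *: "inv s ((f(y := x)) u) < inv s u" if "u \<in> {1..n}" for u
          using \<open>s \<in> lin_exts n (f(y := x))\<close> that by (simp add: lin_exts_def)
        show ?thesis using *[of x] *[of y] *[OF v] that(2-) by (cases "v = y") auto
      qed
      from s this[OF _ ab] this[OF _ ab(2,1) ab(3)[symmetric] ab(4)[symmetric]] show ?thesis by blast
    qed
    with s show "s \<in> lin_exts n f" by (auto simp: lin_exts_def)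
  qed
  show "lin_exts n (f(b := a)) \<inter> lin_exts n (f(a := b)) = {}"
  proof (rule ccontr)
    assume "\<not> ?thesis"
    then obtain s where s: "s \<in> lin_exts n (f(b := a))" "s \<in> lin_exts n (f(a := b))" by blast
    from s(1) have "inv s ((f(b := a)) b) < inv s b" using ab unfolding lin_exts_def by blast
    moreover from s(2) have "inv s ((f(a := b)) a) < inv s a" using ab unfolding lin_exts_def by blast
    ultimately show False by simp
  qed
qed

text \<open>The edge from \<open>b\<close> to its parent cannot arise from a second vertex, since
  the two would then be parents of each other. Hence it really disappears when \<open>b\<close> is
  moved.\<close>

lemma parent_edges_update:
  assumes ac: "acyclic (parent_rel n f)" and b: "b \<in> {1..n}"
  shows "parent_edges n (f(b := a)) = insert (edge a b) (parent_edges n f - {edge (f b) b})"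
proof -
  have "edge (f v) v \<noteq> edge (f b) b" if "v \<in> {1..n}" "v \<noteq> b" for v
  proof
    assume "edge (f v) v = edge (f b) b"
    with that have "f v = b" "f b = v" by (auto simp: edge_eq_iff)
    then have "(b, v) \<in> parent_rel n f" "(v, b) \<in> parent_rel n f"
      using that b by (auto simp: parent_rel_def)
    then have "(b, b) \<in> (parent_rel n f)\<^sup>+" by (meson trancl.intros)
    with ac show False by (auto simp: acyclic_def)
  qed
  then have "parent_edges n f - {edge (f b) b} = (\<lambda>v. edge (f v) v) ` ({1..n} - {b})"
    unfolding parent_edges_def
    by (intro set_eqI iffI; elim DiffE imageE; intro DiffI image_eqI) auto
  also have "\<dots> = (\<lambda>v. edge ((f(b := a)) v) v) ` ({1..n} - {b})"
    by (intro image_cong) auto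
  also have "insert (edge a b) \<dots> = parent_edges n (f(b := a))"
  proof -
    have "parent_edges n (f(b := a)) = (\<lambda>v. edge ((f(b := a)) v) v) ` insert b ({1..n} - {b})"
      unfolding parent_edges_def insert_Diff[OF b] ..
    then show ?thesis by (simp only: image_insert fun_upd_same)
  qed
  finally show ?thesis ..
qed

text \<open>If one sibling were the parent of the other, it would be its own parent as well.\<close>

lemma edge_siblings_notin_parent_edges:
  assumes ac: "acyclic (parent_rel n f)" and ab: "a \<in> {1..n}" "b \<in> {1..n}" "f a = f b"
  shows "edge a b \<notin> parent_edges n f"
proof
  assume "edge a b \<in> parent_edges n f"
  then have "f a = b \<or> f b = a" using ab by (auto simp: parent_edges_def edge_eq_iff)
  then show False using ab acyclic_parent_neq[OF ac] by metis
qed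

lemma parent_edges_subset:
  assumes "acyclic (parent_rel n f)" "\<And>v. v \<in> {1..n} \<Longrightarrow> f v \<le> n"
  shows "parent_edges n f \<subseteq> edges n"
  by (use assms acyclic_parent_neq[OF assms(1)]
    in \<open>auto simp: parent_edges_def intro!: edge_in_edges\<close>)

section \<open>Splitting off a single edge\<close>

lemma inv_sign_edge:
  assumes "inv s a < inv s b"
  shows "inv_sign s (edge a b) = (if a < b then 1 else -1 :: 'a::comm_ring_1)"
  by (use assms in \<open>cases a b rule: linorder_cases; auto simp: inv_sign_def edge_def\<close>)

text \<open>\<open>Y\<close> and \<open>S\<close> are independent parameters because the induction
  removes edges from \<open>Y\<close> and splits \<open>S\<close> separately.\<close>

definition signed_sum :: "nat \<Rightarrow> (nat \<Rightarrow> 'a) \<Rightarrow> (nat \<times> nat) set \<Rightarrow> (nat \<Rightarrow> nat) set \<Rightarrow> 'a::comm_ring_1" where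
  "signed_sum n t Y S = (\<Sum>s\<in>S. (\<Prod>e\<in>Y. inv_sign s e) * bigP n t s)"

text \<open>All permutations in \<open>S\<close> give the new edge the same sign, which therefore
  leaves the sum.\<close>

lemma signed_sum_insert:
  assumes "finite Y" "edge a b \<notin> Y" "\<forall>s\<in>S. inv s a < inv s b"
  shows "signed_sum n t (insert (edge a b) Y) S = (if a < b then 1 else -1) * signed_sum n t Y S"
  by (use assms in \<open>simp add: signed_sum_def sum_distrib_left inv_sign_edge mult.assoc cong: sum.cong\<close>)

lemma pY_insert:
  assumes "finite Y" "edge a b \<notin> Y"
  shows "pY t (insert (edge a b) Y) = (if a < b then 1 else -1) * (t b - t a) * pY t Y"
  by (use assms in \<open>simp add: pY_def edge_eq_if left_diff_distrib split: if_splits\<close>)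

text \<open>Moving \<open>b\<close> below \<open>a\<close> trades the tree edge between
  \<open>f b\<close> and \<open>b\<close> for the one between \<open>a\<close> and \<open>b\<close>.
  The complement of the new tree is thus the displayed edge set plus the former edge. As
  \<open>f b\<close> precedes \<open>b\<close> in every linear extension, that edge contributes the
  same sign on both sides of \<open>IH\<close>, and the factor \<open>t b - t (f b)\<close>
  remains.\<close>

lemma signed_sum_sibling:
  fixes t :: "nat \<Rightarrow> 'a::comm_ring_1"
  assumes ac: "acyclic (parent_rel n f)" and le: "\<And>v. v \<in> {1..n} \<Longrightarrow> f v \<le> n"
    and ab: "a \<in> {1..n}" "b \<in> {1..n}" "a \<noteq> b" "f a = f b"
    and IH: "pY t (edges n - parent_edges n (f(b := a))) =
      signed_sum n t (edges n - parent_edges n (f(b := a))) (lin_exts n (f(b := a)))"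
  shows "signed_sum n t (edges n - parent_edges n f - {edge a b}) (lin_exts n (f(b := a))) =
    (t b - t (f b)) * pY t (edges n - parent_edges n f - {edge a b})"
proof -
  define M where "M = edges n - parent_edges n f - {edge a b}"
  have in_pe: "edge (f b) b \<in> parent_edges n f" using ab by (auto simp: parent_edges_def)
  have ne: "edge (f b) b \<noteq> edge a b"
    using edge_siblings_notin_parent_edges[OF ac ab(1,2,4)] in_pe by metis
  have eq: "edges n - parent_edges n (f(b := a)) = insert (edge (f b) b) M"
    unfolding parent_edges_update[OF ac ab(2)] M_def
    using in_pe ne parent_edges_subset[OF ac le] by (intro equalityI subsetI) auto
  have nin: "edge (f b) b \<notin> M" using in_pe by (simp add: M_def)
  have fin: "finite M" by (simp add: M_def)
  have less: "\<forall>s\<in>lin_exts n (f(b := a)). inv s (f b) < inv s b"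
    using lin_exts_split(1)[OF ab] lin_extsD(2)[OF _ ab(2)] by blast
  \<comment> \<open>The common sign. It is cancelled by multiplying with \<open>w\<close> again,
    since the ring need not admit division.\<close>
  define w :: 'a where "w = (if f b < b then 1 else -1)"
  have ww: "w * w = 1" by (simp add: w_def)
  have "w * ((t b - t (f b)) * pY t M) = w * signed_sum n t M (lin_exts n (f(b := a)))"
    using IH unfolding eq pY_insert[OF fin nin] signed_sum_insert[OF fin nin less] w_def
    by (simp add: mult.assoc)
  then have "w * w * ((t b - t (f b)) * pY t M) = w * w * signed_sum n t M (lin_exts n (f(b := a)))"
    by (simp add: mult.assoc)
  then show ?thesis unfolding ww M_def by simp
qed

section \<open>Injective parent functions\<close>

text \<open>The parent of \<open>s (Suc k)\<close> has position at most \<open>k\<close>. A position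
  \<open>j < k\<close> is impossible: by induction \<open>s j\<close> is the parent of
  \<open>s (Suc j)\<close>, and by injectivity it has no second child.\<close>

lemma lin_exts_inj_parent:
  assumes s: "s \<in> lin_exts n f" and inj: "inj_on f {1..n}" and k: "Suc k \<le> n"
  shows "f (s (Suc k)) = s k"
proof -
  have perm: "s permutes {1..n}" using s by (simp add: lin_exts_def)
  have mem: "s j \<in> {1..n}" if "1 \<le> j" "j \<le> n" for j
    using permutes_in_image[OF perm] that by simp
  have invs: "inv s (s j) = j" "s (inv s j) = j" for j
    using permutes_inverses[OF perm] by auto
  have "f (s (Suc k)) = s k" using k
  proof (induction k rule: less_induct)
    case (less k)
    have "inv s (f (s (Suc k))) < Suc k"
      using lin_extsD(2)[OF s mem[of "Suc k"]] less.prems by (simp add: invs)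
    then have "\<not> inv s (f (s (Suc k))) < k \<Longrightarrow> inv s (f (s (Suc k))) = k" by simp
    moreover have "\<not> inv s (f (s (Suc k))) < k"
    proof
      define j where "j = inv s (f (s (Suc k)))"
      assume "inv s (f (s (Suc k))) < k"
      then have j: "j < k" by (simp add: j_def)
      then have "f (s (Suc j)) = f (s (Suc k))"
        using less.IH[of j] less.prems by (simp add: j_def invs)
      then have "s (Suc j) = s (Suc k)"
        using inj_onD[OF inj _ mem mem] j less.prems by simp
      then have "Suc j = Suc k" using invs(1) by metis
      with j show False by simp
    qed
    ultimately show ?case using invs(2) by metis
  qed
  then show ?thesis .
qed

text \<open>\<open>s\<close> starts at 0, and each further entry is the only child of its
  predecessor.\<close>

lemma lin_exts_inj_unique:
  assumes inj: "inj_on f {1..n}" and s: "s \<in> lin_exts n f" and s': "s' \<in> lin_exts n f"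
  shows "s = s'"
proof
  fix k
  have perm: "s permutes {1..n}" "s' permutes {1..n}" using s s' by (simp_all add: lin_exts_def)
  show "s k = s' k"
  proof (cases "k \<le> n")
    case True
    then show ?thesis
    proof (induction k)
      case 0
      then show ?case using permutes_zero(1)[OF perm(1)] permutes_zero(1)[OF perm(2)] by simp
    next
      case (Suc k)
      then have "f (s (Suc k)) = f (s' (Suc k))"
        using lin_exts_inj_parent[OF s inj] lin_exts_inj_parent[OF s' inj] by simp
      then show ?case
        using inj_onD[OF inj] permutes_in_image[OF perm(1), of "Suc k"]
          permutes_in_image[OF perm(2), of "Suc k"] Suc.prems by simp
    qed
  qed (use perm in \<open>auto simp: permutes_not_in\<close>)
qed

section \<open>Path trees and the products \<open>bigP\<close>\<close>

lemma path_tree_eq: "path_tree n s = (\<lambda>k. edge (s k) (s (Suc k))) ` {..<n}"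
proof -
  have "path_tree n s = (\<lambda>k. edge (s (k - 1)) (s k)) ` Suc ` {..<n}"
    unfolding path_tree_def edge_def image_Suc_lessThan by auto
  then show ?thesis by (simp add: image_image)
qed

text \<open>Pairs of non-consecutive positions correspond to the edges outside the path tree, and
  the signs turn the orientation of G into that of \<open>G^s\<close>.\<close>

lemma bigP_eq:
  fixes t :: "nat \<Rightarrow> 'a::comm_ring_1"
  assumes perm: "s permutes {1..n}"
  shows "bigP n t s = (\<Prod>e\<in>edges n - path_tree n s. inv_sign s e) * pY t (edges n - path_tree n s)"
proof -
  let ?I = "{(i, j). i < j \<and> j \<le> n \<and> j \<noteq> i + (1::nat)}"
  let ?g = "\<lambda>(i, j). edge (s i) (s j)"
  have invs: "inv s (s j) = j" "s (inv s j) = j" for j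
    using permutes_inverses[OF perm] by auto
  have sinj: "s i = s j \<longleftrightarrow> i = j" for i j using permutes_inj[OF perm] by (auto dest: injD)
  have bij: "bij_betw ?g ?I (edges n - path_tree n s)"
    unfolding bij_betw_def
  proof
    show "inj_on ?g ?I" by (rule inj_onI) (auto simp: edge_eq_iff sinj)
    show "?g ` ?I = edges n - path_tree n s"
    proof (intro equalityI subsetI)
      fix e assume "e \<in> ?g ` ?I"
      then obtain i j where "i < j" "j \<le> n" "j \<noteq> i + 1" "e = edge (s i) (s j)" by auto
      moreover from this have "edge (s i) (s j) \<in> edges n"
        by (intro edge_in_edges) (simp_all add: permutes_le_iff[OF perm] sinj)
      ultimately show "e \<in> edges n - path_tree n s"
        by (auto simp: sinj path_tree_eq edge_eq_iff)
    next
      fix e assume e: "e \<in> edges n - path_tree n s"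
      then obtain a b where ab: "e = (a, b)" "a < b" "b \<le> n" by (auto simp: edges_def)
      define i j where "i = min (inv s a) (inv s b)" and "j = max (inv s a) (inv s b)"
      have eab: "e = edge a b" using ab by (simp add: edge_def)
      have "inv s a \<noteq> inv s b" using ab invs by (metis less_irrefl)
      then have "i < j" by (auto simp: i_def j_def)
      have "inv s a \<le> n" "inv s b \<le> n" using ab permutes_le_iff[OF permutes_inv[OF perm]] by auto
      then have "j \<le> n" by (simp add: j_def)
      have eij: "e = edge (s i) (s j)"
        unfolding eab i_def j_def by (auto simp: min_def max_def invs edge_commute)
      have "j \<noteq> i + 1"
        using e eij \<open>j \<le> n\<close> by (auto simp: path_tree_eq)
      then show "e \<in> ?g ` ?I" using \<open>i < j\<close> \<open>j \<le> n\<close> eij by auto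
    qed
  qed
  let ?h = "\<lambda>e. inv_sign s e * (case e of (i, j) \<Rightarrow> t j - t i)"
  have "(\<Prod>e\<in>edges n - path_tree n s. inv_sign s e) * pY t (edges n - path_tree n s)
      = prod ?h (edges n - path_tree n s)"
    by (simp add: pY_def prod.distrib)
  also have "\<dots> = (\<Prod>x\<in>?I. ?h (?g x))"
    by (rule prod.reindex_bij_betw[OF bij, symmetric])
  also have "\<dots> = bigP n t s"
    unfolding bigP_def
  proof (rule prod.cong[OF refl])
    fix x assume "x \<in> ?I"
    then obtain i j where "x = (i, j)" "i < j" by auto
    then show "?h (?g x) = (case x of (i, j) \<Rightarrow> t (s j) - t (s i))"
      using inv_sign_mult_diff[of s "s i" "s j" t] by (simp add: invs)
  qed
  finally show ?thesis ..
qed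

text \<open>The base case: the tree is the path tree of its only linear extension \<open>s\<close>.
  The sum has one term, in which every sign occurs twice, once explicitly and once inside
  \<open>bigP\<close>.\<close>

lemma pY_eq_signed_sum_path:
  fixes t :: "nat \<Rightarrow> 'a::comm_ring_1"
  assumes ac: "acyclic (parent_rel n f)" and le: "\<And>v. v \<in> {1..n} \<Longrightarrow> f v \<le> n"
    and inj: "inj_on f {1..n}"
  shows "pY t (edges n - parent_edges n f) = signed_sum n t (edges n - parent_edges n f) (lin_exts n f)"
proof -
  obtain s where s: "s \<in> lin_exts n f" using lin_exts_nonempty[OF ac le] by blast
  have L: "lin_exts n f = {s}" using s lin_exts_inj_unique[OF inj _ s] by blast
  have perm: "s permutes {1..n}" using s by (simp add: lin_exts_def)
  have "parent_edges n f = (\<lambda>v. edge (f v) v) ` s ` Suc ` {..<n}"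
    unfolding parent_edges_def image_Suc_lessThan permutes_image[OF perm] ..
  also have "\<dots> = path_tree n s"
    unfolding path_tree_eq image_image
    by (rule image_cong) (use lin_exts_inj_parent[OF s inj] in auto)
  finally have pt: "parent_edges n f = path_tree n s" .
  have "(\<Prod>e\<in>Y. inv_sign s e) * (\<Prod>e\<in>Y. inv_sign s e) = (1::'a)" for Y
    by (simp flip: prod.distrib)
  then show ?thesis
    unfolding L pt signed_sum_def by (simp add: bigP_eq[OF perm] flip: mult.assoc)
qed

section \<open>The identity for parent functions\<close>

theorem pY_eq_signed_sum:
  fixes t :: "nat \<Rightarrow> 'a::comm_ring_1"
  assumes "acyclic (parent_rel n f)" and "\<And>v. v \<in> {1..n} \<Longrightarrow> f v \<le> n"
  shows "pY t (edges n - parent_edges n f) = signed_sum n t (edges n - parent_edges n f) (lin_exts n f)"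
  using assms
proof (induction "card (lin_exts n f)" arbitrary: f rule: less_induct)
  case less
  note ac = less.prems(1) and le = less.prems(2)
  show ?case
  proof (cases "inj_on f {1..n}")
    case True
    then show ?thesis using pY_eq_signed_sum_path ac le by blast
  next
    case False
    then obtain a b where ab: "a \<in> {1..n}" "b \<in> {1..n}" "a \<noteq> b" "f a = f b"
      by (auto simp: inj_on_def)
    then have ba: "b \<in> {1..n}" "a \<in> {1..n}" "b \<noteq> a" "f b = f a" by auto
    let ?M = "edges n - parent_edges n f - {edge a b}"
    let ?La = "lin_exts n (f(b := a))" and ?Lb = "lin_exts n (f(a := b))"
    note acs = acyclic_parent_rel_update[OF ac ab] acyclic_parent_rel_update[OF ac ba]
    have les: "(f(b := a)) v \<le> n" "(f(a := b)) v \<le> n" if "v \<in> {1..n}" for v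
      using le[OF that] ab(1,2) by simp_all
    note split = lin_exts_split[OF ab]
    have "?La \<noteq> {}" "?Lb \<noteq> {}"
      using lin_exts_nonempty acs les by blast+
    \<comment> \<open>Each half misses the other one, which is nonempty; this makes the induction on
      the cardinality work.\<close>
    then have "?La \<subset> lin_exts n f" "?Lb \<subset> lin_exts n f" using split by blast+
    then have card: "card ?La < card (lin_exts n f)" "card ?Lb < card (lin_exts n f)"
      by (simp_all add: psubset_card_mono)
    have A: "signed_sum n t ?M ?La = (t b - t (f b)) * pY t ?M"
      by (rule signed_sum_sibling[OF ac le ab less.hyps[OF card(1) acs(1) les(1)]])
    have B: "signed_sum n t ?M ?Lb = (t a - t (f a)) * pY t ?M"
      using signed_sum_sibling[OF ac le ba less.hyps[OF card(2) acs(2) les(2)]]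
      by (simp add: edge_commute)
    have eq: "edges n - parent_edges n f = insert (edge a b) ?M"
      using edge_siblings_notin_parent_edges[OF ac ab(1,2,4)] edge_in_edges[of a b n] ab by auto
    have nin: "edge a b \<notin> ?M" "edge b a \<notin> ?M" by (auto simp: edge_commute)
    have fin: "finite ?M" by simp
    have lessA: "\<forall>s\<in>?La. inv s a < inv s b"
      using lin_extsD(2)[where f = "f(b := a)" and v = b] ab(2) by simp
    have lessB: "\<forall>s\<in>?Lb. inv s b < inv s a"
      using lin_extsD(2)[where f = "f(a := b)" and v = a] ab(1) by simp
    \<comment> \<open>The sign of \<open>edge a b\<close> on the first half. On the second half it
      is \<open>- w\<close>, so the two contributions are subtracted and the terms with the common
      parent cancel.\<close>
    define w :: 'a where "w = (if a < b then 1 else -1)"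
    have w': "(if b < a then 1 else -1) = - w" using ab by (auto simp: w_def)
    have "signed_sum n t (insert (edge a b) ?M) (lin_exts n f) =
        signed_sum n t (insert (edge a b) ?M) ?La + signed_sum n t (insert (edge a b) ?M) ?Lb"
      unfolding split(1) signed_sum_def by (rule sum.union_disjoint) (use split(2) in auto)
    also have "signed_sum n t (insert (edge a b) ?M) ?La = w * ((t b - t (f b)) * pY t ?M)"
      unfolding signed_sum_insert[OF fin nin(1) lessA] A w_def ..
    also have "signed_sum n t (insert (edge a b) ?M) ?Lb = - w * ((t a - t (f a)) * pY t ?M)"
      using signed_sum_insert[OF fin nin(2) lessB, of n t]
      unfolding B w' edge_commute[of b a] .
    also have "w * ((t b - t (f b)) * pY t ?M) + - w * ((t a - t (f a)) * pY t ?M)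
        = w * (t b - t a) * pY t ?M"
      by (simp add: ab(4) algebra_simps)
    also have "\<dots> = pY t (insert (edge a b) ?M)"
      unfolding pY_insert[OF fin nin(1)] w_def ..
    finally show ?thesis unfolding eq[symmetric] by (rule sym)
  qed
qed

section \<open>Spanning trees as parent functions\<close>

lemma adj_iff: "adj T a b \<longleftrightarrow> a \<noteq> b \<and> edge a b \<in> T"
  by (simp add: adj_def edge_def)

lemma adj_commute: "adj T a b \<longleftrightarrow> adj T b a"
  by (auto simp: adj_iff edge_commute)

lemma is_path_iff: "is_path T p \<longleftrightarrow> p \<noteq> [] \<and> distinct p \<and> successively (adj T) p"
  by (auto simp: is_path_def successively_conv_nth)

lemma is_path_prefix: "is_path T (xs @ ys) \<Longrightarrow> xs \<noteq> [] \<Longrightarrow> is_path T xs"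
  by (auto simp: is_path_iff successively_append_iff)

lemma is_path_snoc:
  "is_path T p \<Longrightarrow> b \<notin> set p \<Longrightarrow> adj T (last p) b \<Longrightarrow> is_path T (p @ [b])"
  by (auto simp: is_path_iff successively_append_iff)

text \<open>A common first step is removed by induction, so it remains to treat paths that part at
  once.\<close>

lemma path_unique:
  assumes acyc: "\<nexists>c. is_cycle T c"
  shows "is_path T p \<Longrightarrow> is_path T q \<Longrightarrow> hd p = hd q \<Longrightarrow> last p = last q \<Longrightarrow> p = q"
proof (induction p arbitrary: q)
  case Nil
  then show ?case by (simp add: is_path_iff)
next
  case (Cons a p q)
  then obtain q' where q: "q = a # q'" by (cases q) (auto simp: is_path_iff)
  have dist: "a \<notin> set p" "distinct p" "a \<notin> set q'" "distinct q'"
    using Cons.prems q by (auto simp: is_path_iff)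
  show ?case
  proof (cases "p = [] \<or> q' = []")
    case True
    \<comment> \<open>If one path is just \<open>[a]\<close>, the other also ends in
      \<open>a\<close> and, being free of repetitions, is \<open>[a]\<close> too.\<close>
    then show ?thesis using Cons.prems(4) dist q by (metis last_ConsL last_ConsR last_in_set)
  next
    case False
    have last: "last p = last q'" using Cons.prems(4) False q by simp
    show ?thesis
    proof (cases "hd p = hd q'")
      case True
      have "is_path T p" "is_path T q'"
        using Cons.prems(1,2) False q by (auto simp: is_path_iff successively_Cons)
      from Cons.IH[OF this True last] q show ?thesis by simp
    next
      case neq: False
      have "\<exists>x\<in>set p. x \<in> set q'" using False last by (metis last_in_set)
      then obtain p1 x p2 where p: "p = p1 @ x # p2" "x \<in> set q'" "\<forall>y\<in>set p1. y \<notin> set q'"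
        by (auto dest!: split_list_first_prop)
      then obtain q1 q2 where q': "q' = q1 @ x # q2" by (auto dest!: split_list)
      \<comment> \<open>The two paths part at a and meet again for the first time at x, which closes a cycle.\<close>
      have "is_path T ((a # p1 @ [x]) @ p2)" "is_path T ((a # q1 @ [x]) @ q2)"
        using Cons.prems(1,2) p q q' by simp_all
      then have P: "is_path T (a # p1 @ [x])" and Q: "is_path T (a # q1 @ [x])"
        by (auto dest!: is_path_prefix simp only: list.distinct)
      have "successively (adj T) (rev (a # q1 @ [x]))"
        using Q unfolding successively_rev is_path_iff by (simp add: adj_commute[of T])
      then have "successively (adj T) ((x # rev q1) @ [a])" by simp
      then have "successively (adj T) (x # rev q1)" "adj T (last (x # rev q1)) a"
        unfolding successively_append_iff by (simp_all only: list.distinct list.sel simp_thms)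
      then have "is_path T (a # p1 @ x # rev q1)" "adj T (last (a # p1 @ x # rev q1)) a"
        using P Q p q' dist
        by (auto simp: is_path_iff successively_append_iff successively_Cons hd_append split: if_splits)
      \<comment> \<open>\<open>p1\<close> and \<open>q1\<close> are not both empty, since otherwise
        \<open>x\<close> would be the first vertex of both \<open>p\<close> and
        \<open>q'\<close>.\<close>
      moreover have "length (a # p1 @ x # rev q1) \<ge> 3"
        using neq p q' by (cases p1; cases q1) auto
      ultimately have "is_cycle T (a # p1 @ x # rev q1)" by (simp add: is_cycle_def)
      with acyc show ?thesis by blast
    qed
  qed
qed

text \<open>The parent of \<open>v\<close> is the last vertex but one on the path from 0 to
  \<open>v\<close>. The last two conclusions link \<open>f\<close> to the tree order: parents
  precede children, and every step of a path from 0 leads from a parent to a child. The form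
  \<open>hd (xs @ [a]) = 0\<close> also covers an empty \<open>xs\<close>.\<close>

lemma spanning_tree_parent:
  assumes tree: "spanning_tree n T"
  obtains f where "acyclic (parent_rel n f)" "\<And>v. v \<in> {1..n} \<Longrightarrow> f v \<le> n"
    "parent_edges n f = T" "\<And>v. v \<in> {1..n} \<Longrightarrow> tree_prec T (f v) v"
    "\<And>xs a b ys. is_path T (xs @ a # b # ys) \<Longrightarrow> hd (xs @ [a]) = 0 \<Longrightarrow> b \<in> {1..n} \<and> f b = a"
proof -
  have acyc: "\<nexists>c. is_cycle T c" and sub: "T \<subseteq> edges n"
    using tree by (auto simp: spanning_tree_def)
  have "\<forall>j. \<exists>p. j \<le> n \<longrightarrow> is_path T p \<and> hd p = 0 \<and> last p = j"
    using tree by (auto simp: spanning_tree_def)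
  then obtain P where "\<forall>j. j \<le> n \<longrightarrow> is_path T (P j) \<and> hd (P j) = 0 \<and> last (P j) = j"
    by metis
  then have P: "is_path T (P j)" "hd (P j) = 0" "last (P j) = j" if "j \<le> n" for j
    using that by auto
  have P_unique: "P (last p) = p" if "is_path T p" "hd p = 0" "last p \<le> n" for p
    using path_unique[OF acyc P(1) that(1)] P(2,3) that by simp
  have adj_le: "a \<le> n \<and> b \<le> n" if "adj T a b" for a b
    using that sub by (auto simp: adj_def edges_def)
  define f where "f v = last (butlast (P v))" for v
  \<comment> \<open>By uniqueness, the path to \<open>v\<close> without its last vertex is the
    chosen path to \<open>f v\<close>.\<close>
  have split: "\<exists>xs. P v = xs @ [f v, v] \<and> P (f v) = xs @ [f v] \<and> adj T (f v) v" if v: "v \<in> {1..n}" for v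
  proof -
    have Pv: "is_path T (P v)" "hd (P v) = 0" "last (P v) = v" using P[of v] v by auto
    then have ne: "P v \<noteq> []" by (simp add: is_path_iff)
    then have e1: "P v = butlast (P v) @ [v]" using Pv(3) append_butlast_last_id by metis
    have "butlast (P v) \<noteq> []"
    proof
      assume "butlast (P v) = []"
      then have "P v = [v]" using e1 by simp
      with Pv(2) v show False by simp
    qed
    then obtain xs where "butlast (P v) = xs @ [f v]"
      unfolding f_def by (metis append_butlast_last_id)
    with e1 have e2: "P v = xs @ [f v, v]" by simp
    then have adj: "adj T (f v) v" using Pv(1) by (simp add: is_path_iff successively_append_iff)
    have "is_path T ((xs @ [f v]) @ [v])" using Pv(1) e2 by simp
    then have "is_path T (xs @ [f v])" by (rule is_path_prefix) simp
    moreover have "hd (xs @ [f v]) = 0" using Pv(2) e2 by (cases xs) auto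
    ultimately have "P (last (xs @ [f v])) = xs @ [f v]"
      using adj_le[OF adj] by (intro P_unique) auto
    with e2 adj show ?thesis by auto
  qed
  \<comment> \<open>The path from 0 gets longer from parent to child, which excludes cycles.\<close>
  have "parent_rel n f \<subseteq> measure (\<lambda>v. length (P v))"
    using split by (fastforce simp: parent_rel_def)
  then have 1: "acyclic (parent_rel n f)" by (intro wf_acyclic wf_subset[OF wf_measure])
  have 2: "f v \<le> n" if "v \<in> {1..n}" for v using split[OF that] adj_le by blast
  have 4: "tree_prec T (f v) v" if v: "v \<in> {1..n}" for v
  proof -
    have "f v \<noteq> v" "f v \<in> set (P v)" using split[OF v] by (auto simp: adj_def)
    then show ?thesis unfolding tree_prec_def using P[of v] v by auto
  qed
  have 5: "b \<in> {1..n} \<and> f b = a" if p: "is_path T (xs @ a # b # ys)" "hd (xs @ [a]) = 0" for xs a b ys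
  proof -
    have "is_path T ((xs @ [a, b]) @ ys)" using p by simp
    then have q: "is_path T (xs @ [a, b])" by (rule is_path_prefix) simp
    then have "adj T a b" by (simp add: is_path_iff successively_append_iff)
    then have "b \<le> n" using adj_le by blast
    have hd: "hd (xs @ [a, b]) = 0" using p(2) by (cases xs) auto
    have "P (last (xs @ [a, b])) = xs @ [a, b]" using q hd \<open>b \<le> n\<close> by (intro P_unique) auto
    then have "f b = a" by (simp add: f_def butlast_append)
    moreover have "b \<noteq> 0" using q p(2) by (cases xs) (auto simp: is_path_iff)
    ultimately show ?thesis using \<open>b \<le> n\<close> by simp
  qed
  have 3: "parent_edges n f = T"
  proof (intro equalityI subsetI)
    fix e assume "e \<in> parent_edges n f"
    then obtain v where "v \<in> {1..n}" "e = edge (f v) v" by (auto simp: parent_edges_def)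
    then show "e \<in> T" using split[of v] by (auto simp: adj_iff)
  next
    fix e assume e: "e \<in> T"
    then obtain i j where ij: "e = (i, j)" "i < j" "j \<le> n" using sub by (auto simp: edges_def)
    then have eij: "e = edge i j" by (simp add: edge_def)
    have adj: "adj T i j" "adj T j i" using e ij eij by (auto simp: adj_iff edge_commute)
    have ext: "b \<in> {1..n} \<and> f b = a"
      if a: "a \<le> n" "b \<notin> set (P a)" "adj T a b" for a b
    proof -
      obtain xs where xs: "P a = xs @ [a]"
        using P[OF a(1)] by (metis append_butlast_last_id is_path_iff)
      have "is_path T (xs @ [a, b])"
        using is_path_snoc[OF P(1) a(2)] P(3) a xs by simp
      then show ?thesis using 5[of xs a b "[]"] P(2)[OF a(1)] xs by simp
    qed
    \<comment> \<open>If \<open>j\<close> lies on the path to \<open>i\<close>, the path to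
      \<open>j\<close> is an initial segment that stops before \<open>i\<close>. So one endpoint
      extends the path to the other and has it as parent.\<close>
    have "j \<notin> set (P i) \<or> i \<notin> set (P j)"
    proof (rule ccontr)
      assume "\<not> ?thesis"
      then obtain xs ys where xs: "P i = xs @ j # ys" and i: "i \<in> set (P j)"
        by (auto dest: split_list)
      have Pi: "is_path T (xs @ j # ys)" "hd (xs @ j # ys) = 0" "last (xs @ j # ys) = i"
        using P[of i] ij xs by auto
      have "is_path T ((xs @ [j]) @ ys)" using Pi by simp
      then have "is_path T (xs @ [j])" by (rule is_path_prefix) simp
      moreover have "hd (xs @ [j]) = 0" using Pi by (cases xs) auto
      ultimately have Pj: "P j = xs @ [j]" using P_unique[of "xs @ [j]"] ij by simp
      have "ys \<noteq> []" using Pi(3) ij by auto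
      then have "i \<in> set ys" using Pi(3) by (metis last_ConsR last_appendR last_in_set list.distinct(1))
      then have "i \<notin> set (xs @ [j])" using Pi(1) by (auto simp: is_path_iff)
      with i Pj show False by simp
    qed
    then have "(j \<in> {1..n} \<and> f j = i) \<or> (i \<in> {1..n} \<and> f i = j)"
      using ext[of i j] ext[of j i] adj ij by auto
    then show "e \<in> parent_edges n f"
      unfolding parent_edges_def eij by (auto simp: edge_commute)
  qed
  show thesis using that[OF 1 2 3 4 5] .
qed

section \<open>Compatibility with a path tree\<close>

text \<open>The witness is the path \<open>s 0, ..., s j\<close>, which starts at 0 because
  \<open>s\<close> fixes 0.\<close>

lemma tree_prec_path_treeI:
  assumes perm: "s permutes {1..n}" and ij: "i < j" "j \<le> n"
  shows "tree_prec (path_tree n s) (s i) (s j)"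
proof -
  have inj: "inj s" using permutes_inj[OF perm] .
  have "is_path (path_tree n s) (map s [0..<Suc j])"
    unfolding is_path_def
  proof (intro conjI allI impI)
    show "map s [0..<Suc j] \<noteq> []" by simp
    show "distinct (map s [0..<Suc j])"
      unfolding distinct_map using inj_on_subset[OF inj] by (simp del: upt_Suc)
    fix k assume "Suc k < length (map s [0..<Suc j])"
    then have k: "Suc k \<le> j" by simp
    have "s k \<noteq> s (Suc k)" using injD[OF inj, of k "Suc k"] by auto
    then show "adj (path_tree n s) (map s [0..<Suc j] ! k) (map s [0..<Suc j] ! Suc k)"
      using k ij by (simp add: adj_iff path_tree_eq nth_map_upt del: upt_Suc)
  qed
  moreover have "hd (map s [0..<Suc j]) = 0" "last (map s [0..<Suc j]) = s j"
    using permutes_zero(1)[OF perm] by (simp_all add: hd_map del: upt_Suc) (simp add: last_map)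
  moreover have "s i \<in> set (map s [0..<Suc j])" using ij by auto
  moreover have "s i \<noteq> s j" using injD[OF inj, of i j] ij by auto
  ultimately show ?thesis unfolding tree_prec_def by blast
qed

text \<open>A path from 0 in the path tree runs through the positions 0, 1, 2, ... in turn: each
  step changes the position by one, and a step back would repeat a vertex.\<close>

lemma tree_prec_path_treeD:
  assumes perm: "s permutes {1..n}" and prec: "tree_prec (path_tree n s) i j"
  shows "inv s i < inv s j"
proof -
  have invs: "inv s (s k) = k" "s (inv s k) = k" for k
    using permutes_inverses[OF perm] by auto
  obtain p where p: "is_path (path_tree n s) p" "hd p = 0" "last p = j" "i \<in> set p" and "i \<noteq> j"
    using prec by (auto simp: tree_prec_def)
  have ne: "p \<noteq> []" and dist: "distinct p" using p by (auto simp: is_path_iff)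
  have pos: "inv s (p ! k) = k" if "k < length p" for k
    using that
  proof (induction k rule: less_induct)
    case (less k)
    show ?case
    proof (cases k)
      case 0
      then show ?thesis using p(2) ne permutes_zero(2)[OF perm] by (simp add: hd_conv_nth)
    next
      case (Suc m)
      then have "adj (path_tree n s) (p ! m) (p ! k)"
        using p(1) less.prems by (simp add: is_path_def)
      then obtain l where l: "edge (p ! m) (p ! k) = edge (s l) (s (Suc l))"
        by (auto simp: adj_iff path_tree_eq)
      have IH: "inv s (p ! m) = m" using less Suc by simp
      from l consider "p ! m = s l" "p ! k = s (Suc l)" | "p ! m = s (Suc l)" "p ! k = s l"
        by (auto simp: edge_eq_iff)
      then show ?thesis
      proof cases
        case 1
        then show ?thesis using IH Suc by (simp add: invs)
      next
        case 2
        then have m: "m = Suc l" using IH by (simp add: invs)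
        then have "inv s (p ! l) = l" using less Suc by simp
        then have "p ! l = p ! k" using 2(2) invs(2) by metis
        then have False using dist less.prems Suc m by (simp add: nth_eq_iff_index_eq)
        then show ?thesis ..
      qed
    qed
  qed
  obtain m where m: "m < length p" "p ! m = i" using p(4) by (auto simp: in_set_conv_nth)
  have j: "p ! (length p - 1) = j" using p(3) ne by (simp add: last_conv_nth)
  have "m \<noteq> length p - 1" using m(2) j \<open>i \<noteq> j\<close> by blast
  with m(1) have "m < length p - 1" by simp
  then show ?thesis using pos[of m] pos[of "length p - 1"] unfolding m(2) j by simp
qed

text \<open>The order of the path tree is already total on the vertices, so the order by positions
  is the only possible witness. It extends the order of \<open>T\<close> as soon as it puts parents
  before children.\<close>

lemma compatible_path_tree_iff:
  assumes perm: "s permutes {1..n}"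
    and ac: "acyclic (parent_rel n f)" and le: "\<And>v. v \<in> {1..n} \<Longrightarrow> f v \<le> n"
    and prec: "\<And>v. v \<in> {1..n} \<Longrightarrow> tree_prec T (f v) v"
    and path: "\<And>xs a b ys. is_path T (xs @ a # b # ys) \<Longrightarrow> hd (xs @ [a]) = 0 \<Longrightarrow> b \<in> {1..n} \<and> f b = a"
  shows "compatible n T (path_tree n s) \<longleftrightarrow> s \<in> lin_exts n f"
proof
  have invs: "inv s (s k) = k" "s (inv s k) = k" for k
    using permutes_inverses[OF perm] by auto
  note inv_le = permutes_le_iff[OF permutes_inv[OF perm]]
  {
    assume "compatible n T (path_tree n s)"
    then obtain R where R: "strict_linear_order_on {0..n} R"
      "\<And>i j. i \<le> n \<Longrightarrow> j \<le> n \<Longrightarrow> tree_prec T i j \<or> tree_prec (path_tree n s) i j \<Longrightarrow> (i, j) \<in> R"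
      unfolding compatible_def by blast
    have "inv s (f v) < inv s v" if v: "v \<in> {1..n}" for v
    proof (rule ccontr)
      assume "\<not> ?thesis"
      moreover have "inv s (f v) \<noteq> inv s v"
        using acyclic_parent_neq[OF ac v] invs(2) by metis
      ultimately have "inv s v < inv s (f v)" by simp
      then have "tree_prec (path_tree n s) (s (inv s v)) (s (inv s (f v)))"
        using le[OF v] by (intro tree_prec_path_treeI[OF perm]) (auto simp: inv_le)
      then have "(v, f v) \<in> R" using R(2) le[OF v] v by (simp add: invs)
      moreover have "(f v, v) \<in> R" using R(2) prec[OF v] le[OF v] v by simp
      ultimately have "(v, v) \<in> R" using R(1) by (auto simp: strict_linear_order_on_def dest: transD)
      with R(1) show False by (auto simp: strict_linear_order_on_def irrefl_def)
    qed
    with perm show "s \<in> lin_exts n f" by (simp add: lin_exts_def)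
  next
    assume s: "s \<in> lin_exts n f"
    define R where "R = {(a, b). inv s a < inv s b}"
    have "strict_linear_order_on {0..n} R"
      unfolding strict_linear_order_on_def
    proof (intro conjI)
      show "trans R" by (auto simp: R_def trans_def)
      show "irrefl R" by (auto simp: R_def irrefl_def)
      show "total_on {0..n} R"
        unfolding total_on_def R_def using invs(2) by (auto simp: not_less) (metis le_neq_implies_less)
    qed
    moreover have "(i, j) \<in> R" if ij: "tree_prec T i j" for i j
    proof -
      obtain p where p: "is_path T p" "hd p = 0" "last p = j" "i \<in> set p" and "i \<noteq> j"
        using ij by (auto simp: tree_prec_def)
      \<comment> \<open>Each step of a path from 0 leads from a parent to its child, so the
        positions increase along it.\<close>
      have "successively (\<lambda>a b. inv s a < inv s b) p"
        unfolding successively_conv_nth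
      proof (intro allI impI)
        fix k assume k: "Suc k < length p"
        have eq: "p = take k p @ p ! k # p ! Suc k # drop (Suc (Suc k)) p"
          using k by (simp add: Cons_nth_drop_Suc)
        have "hd (take k p @ [p ! k]) = 0"
          using p(2) k by (cases k; cases p) auto
        then have "p ! Suc k \<in> {1..n} \<and> f (p ! Suc k) = p ! k"
          using path[of "take k p" "p ! k" "p ! Suc k"] p(1) eq by metis
        then show "inv s (p ! k) < inv s (p ! Suc k)" using lin_extsD(2)[OF s] by metis
      qed
      then have "sorted_wrt (\<lambda>a b. inv s a < inv s b) p"
        by (subst (asm) successively_iff_sorted_wrt_strong) auto
      moreover obtain xs ys where eq: "p = xs @ i # ys" using p(4) by (auto dest: split_list)
      moreover have "j \<in> set ys"
        using p(3) \<open>i \<noteq> j\<close> eq by (cases "ys = []") auto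
      ultimately show ?thesis by (simp add: R_def sorted_wrt_append)
    qed
    moreover have "(i, j) \<in> R" if "tree_prec (path_tree n s) i j" for i j
      using tree_prec_path_treeD[OF perm that] by (simp add: R_def)
    ultimately show "compatible n T (path_tree n s)" unfolding compatible_def by blast
  }
qed

text \<open>Checks the definitions rather than serving the identity: the existential quantifier over
paths in the tree order of T_s ranges over a single path.\<close>

lemma spanning_tree_path_tree:
  assumes perm: "s permutes {1..n}"
  shows "spanning_tree n (path_tree n s)"
  unfolding spanning_tree_def
proof (intro conjI allI impI notI)
  have invs: "inv s (s k) = k" "s (inv s k) = k" for k
    using permutes_inverses[OF perm] by auto
  have sinj: "s i = s j \<longleftrightarrow> i = j" for i j using permutes_inj[OF perm] by (auto dest: injD)
  show "path_tree n s \<subseteq> edges n"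
    by (auto simp: path_tree_eq sinj permutes_le_iff[OF perm] intro!: edge_in_edges)
  show "\<exists>p. is_path (path_tree n s) p \<and> hd p = 0 \<and> last p = j" if j: "j \<le> n" for j
  proof (cases "inv s j = 0")
    case True
    then have "j = 0" using invs(2)[of j] permutes_zero(1)[OF perm] by simp
    then show ?thesis by (intro exI[of _ "[0]"]) (simp add: is_path_iff)
  next
    case False
    then have "tree_prec (path_tree n s) (s 0) (s (inv s j))"
      using j permutes_le_iff[OF permutes_inv[OF perm]]
      by (intro tree_prec_path_treeI[OF perm]) auto
    then show ?thesis by (auto simp: tree_prec_def invs)
  qed
  assume "\<exists>c. is_cycle (path_tree n s) c"
  then obtain c where c: "is_cycle (path_tree n s) c" ..
  \<comment> \<open>Positions along the cycle, taken as integers so that differences may be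
    negative.\<close>
  define q where "q k = int (inv s (c ! k))" for k
  have adj: "\<bar>int (inv s b) - int (inv s a)\<bar> = 1" if ab: "adj (path_tree n s) a b" for a b
  proof -
    obtain k where "a = s k \<and> b = s (Suc k) \<or> a = s (Suc k) \<and> b = s k"
      using ab by (auto simp: adj_iff path_tree_eq edge_eq_iff)
    then show ?thesis by (auto simp: invs)
  qed
  have len: "length c \<ge> 3" "c \<noteq> []" using c by (auto simp: is_cycle_def is_path_def)
  have step: "\<bar>q (Suc k) - q k\<bar> = 1" if "Suc k < length c" for k
    unfolding q_def by (rule adj) (use c that in \<open>simp add: is_cycle_def is_path_def\<close>)
  have neq: "q k \<noteq> q l" if "k < length c" "l < length c" "k \<noteq> l" for k l
  proof -
    have "c ! k \<noteq> c ! l" using c that by (simp add: is_cycle_def is_path_def nth_eq_iff_index_eq)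
    then have "inv s (c ! k) \<noteq> inv s (c ! l)" using invs(2) by metis
    then show ?thesis by (simp add: q_def)
  qed
  \<comment> \<open>Since q does not revisit a value, all its steps have the same sign.\<close>
  define d where "d = q 1 - q 0"
  have diff: "q (Suc k) - q k = d" if "Suc k < length c" for k
    using that
  proof (induction k)
    case 0
    then show ?case by (simp add: d_def)
  next
    case (Suc k)
    then show ?case
      using step[of k] step[of "Suc k"] neq[of "Suc (Suc k)" k] by linarith
  qed
  have q: "q k = q 0 + int k * d" if "k < length c" for k
    using that
  proof (induction k)
    case (Suc k)
    have "q (Suc k) = q k + d" using diff[OF Suc.prems] by linarith
    moreover have "q k = q 0 + int k * d" using Suc by simp
    ultimately show ?case by (simp add: distrib_right)
  qed simp
  \<comment> \<open>With steps of constant sign, the last position is at distance at least 2 from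
    the first, whereas the closing edge demands distance 1.\<close>
  have "q (length c - 1) = q 0 + int (length c - 1) * d"
    by (rule q) (use len in simp)
  moreover have "\<bar>q 0 - q (length c - 1)\<bar> = 1"
    using adj[of "last c" "hd c"] c len by (simp add: q_def is_cycle_def hd_conv_nth last_conv_nth)
  ultimately have "int (length c - 1) * \<bar>d\<bar> = 1"
    by (simp add: abs_mult)
  then show False using step[of 0] len by (simp add: d_def)
qed

theorem theorem3p3:
  fixes n :: nat and T :: "(nat \<times> nat) set" and t :: "nat \<Rightarrow> 'a::comm_ring_1"
  assumes "spanning_tree n T" and "t 0 = 0"
  shows "pY t (edges n - T) =
    (\<Sum>s\<in>{s. s permutes {1..n}}.
       (-1) ^ mm (edges n - T) s * C n T (path_tree n s) * bigP n t s)"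
proof -
  obtain f where f: "acyclic (parent_rel n f)" "\<And>v. v \<in> {1..n} \<Longrightarrow> f v \<le> n"
    "parent_edges n f = T" "\<And>v. v \<in> {1..n} \<Longrightarrow> tree_prec T (f v) v"
    "\<And>xs a b ys. is_path T (xs @ a # b # ys) \<Longrightarrow> hd (xs @ [a]) = 0 \<Longrightarrow> b \<in> {1..n} \<and> f b = a"
    using spanning_tree_parent[OF assms(1)] by blast
  have "pY t (edges n - T) = signed_sum n t (edges n - T) (lin_exts n f)"
    using pY_eq_signed_sum[OF f(1,2), of t] f(3) by simp
  \<comment> \<open>The factor \<open>C\<close> is 1 on the linear extensions and 0 on all other
    permutations.\<close>
  also have "\<dots> = (\<Sum>s\<in>{s. s permutes {1..n}}.
       (-1) ^ mm (edges n - T) s * C n T (path_tree n s) * bigP n t s)"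
    unfolding signed_sum_def
  proof (rule sum.mono_neutral_cong_left)
    show "finite {s. s permutes {1..n}}" by (rule finite_permutations) simp
    show "lin_exts n f \<subseteq> {s. s permutes {1..n}}" by (auto simp: lin_exts_def)
    show "\<forall>s\<in>{s. s permutes {1..n}} - lin_exts n f.
        (-1) ^ mm (edges n - T) s * C n T (path_tree n s) * bigP n t s = 0"
      using compatible_path_tree_iff[OF _ f(1,2,4,5)] by (auto simp: C_def)
    fix s assume s: "s \<in> lin_exts n f"
    then have "C n T (path_tree n s) = (1::'a)"
      using compatible_path_tree_iff[OF lin_extsD(1)[OF s] f(1,2,4,5)] by (simp add: C_def)
    then show "(\<Prod>e\<in>edges n - T. inv_sign s e) * bigP n t s =
        (-1) ^ mm (edges n - T) s * C n T (path_tree n s) * bigP n t s"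
      by (simp add: minus_one_power_mm)
  qed
  finally show ?thesis .
qed

end
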